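(* Let $n \ge 1$ and $k \ge 1$ be integers. Then $$S_{2k} = \frac{1}{2} (-1)^k \, \frac{d^{2k}}{dx^{2k}} \Big( U_{2n}\big(\cos(x/2)\big) \Big)\Big|_{x=0}$$ and $$S_{2k-1} = (-1)^{k-1} \, \frac{d^{2k-1}}{dx^{2k-1}} \Big( U_{n}\big(\cos(x/2)\big) \sin(nx/2) \Big)\Big|_{x=0}.$$
   Context: For integers $m \ge 0$ and $n \ge 1$, $S_m = 1^m + 2^m + \cdots + n^m$ denotes the sum of the $m$th powers of the first $n$ positive integers (the dependence on $n$ is suppressed in the notation). The Chebyshev polynomials of the second kind $U_n(x)$ are defined by $U_0(x)=1$, $U_1(x)=2x$, and $U_n(x) = 2xU_{n-1}(x) - U_{n-2}(x)$ for $n \ge 2$. Here $x$ is a real variable. *)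

theory Defs
  imports "HOL-Analysis.Analysis" "HOL-Computational_Algebra.Polynomial"
begin

definition power_sum :: "nat \<Rightarrow> nat \<Rightarrow> nat" where
  "power_sum n m = (\<Sum>j=1..n. j ^ m)"

text \<open>Chebyshev polynomials of the second kind; \<open>[:0, 2:]\<close> is the polynomial \<open>2x\<close>.\<close>

fun cheb_U :: "nat \<Rightarrow> real poly" where
  "cheb_U 0 = 1"
| "cheb_U (Suc 0) = [:0, 2:]"
| "cheb_U (Suc (Suc n)) = [:0, 2:] * cheb_U (Suc n) - cheb_U n"

end

theory Submission
  imports Defs
begin

text \<open>
  Both functions are finite trigonometric sums in disguise. With \<open>t = x / 2\<close>, the polynomial
  \<open>cheb_U n\<close> evaluated at \<open>cos t\<close> is \<open>sin ((n + 1) t) / sin t\<close>, so the classical closed forms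
  of the Dirichlet kernel and its conjugate give
  \<open>1 + 2 (cos x + \<dots> + cos (n x))\<close> for the first function (lemma \<open>cheb_U_even_cos\<close>) and
  \<open>sin x + \<dots> + sin (n x)\<close> for the second (lemma \<open>cheb_U_cos_mult_sin\<close>). Differentiating \<open>m\<close>
  times multiplies the \<open>j\<close>-th term by \<open>j ^ m\<close> and shifts its phase by \<open>m\<close> quarter turns (lemma
  \<open>funpow_deriv_sum_sin\<close>). At \<open>0\<close> the shifted sines are all equal to the same sign, which leaves
  that sign times the sum of the \<open>m\<close>-th powers.

  The point \<open>x = 0\<close> is exactly where \<open>sin (x / 2)\<close> vanishes. The quotient is therefore never
  formed: the identities are obtained, for every \<open>t\<close>, from recurrences in \<open>n\<close> free of division.
\<close>

lemma cheb_U_cos_mult_sin_angle: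
  "poly (cheb_U n) (cos t) * sin t = sin (real (Suc n) * t)"
proof (induction n rule: cheb_U.induct)
  case 2
  show ?case by (simp add: sin_double)
next
  case (3 n)
  have "sin (real (Suc (Suc (Suc n))) * t) + sin (real (Suc n) * t)
      = 2 * cos t * sin (real (Suc (Suc n)) * t)"
    using sin_add[of "real (Suc (Suc n)) * t" t] sin_diff[of "real (Suc (Suc n)) * t" t]
    by (simp add: algebra_simps)
  with 3 show ?case
    by (simp add: left_diff_distrib mult.assoc)
qed simp

text \<open>
  The first-order form of the recurrence: multiplied by \<open>sin t\<close>, it is the addition theorem for
  \<open>sin ((n + 1) t + t)\<close>.
\<close>

lemma cheb_U_Suc_cos:
  "poly (cheb_U (Suc n)) (cos t) = cos t * poly (cheb_U n) (cos t) + cos (real (Suc n) * t)"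
proof (induction n)
  case (Suc n)
  let ?U = "\<lambda>n. poly (cheb_U n) (cos t)"
  have "cos (real (Suc (Suc n)) * t) = cos t * cos (real (Suc n) * t) - ?U n * sin t * sin t"
    using cos_add[of "real (Suc n) * t" t] cheb_U_cos_mult_sin_angle[of n t]
    by (simp add: algebra_simps)
  also have "\<dots> = cos t * cos (real (Suc n) * t) - ?U n * (1 - cos t * cos t)"
    using sin_squared_eq[of t] by (simp add: power2_eq_square mult.assoc)
  finally show ?case
    using Suc.IH by (simp add: algebra_simps)
qed simp

text \<open>In polynomial form, this is the relation \<open>U (n + 2) - U n = 2 T (n + 2)\<close> to the Chebyshev
  polynomials of the first kind.\<close>

lemma cheb_U_Suc_Suc_cos:
  "poly (cheb_U (Suc (Suc n))) (cos t) = poly (cheb_U n) (cos t) + 2 * cos (real (Suc (Suc n)) * t)"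
proof -
  let ?U = "\<lambda>n. poly (cheb_U n) (cos t)"
  have "?U (Suc (Suc n)) = 2 * (cos t * ?U (Suc n)) - ?U n"
    by simp
  moreover have "?U (Suc (Suc n)) = cos t * ?U (Suc n) + cos (real (Suc (Suc n)) * t)"
    by (rule cheb_U_Suc_cos)
  ultimately show ?thesis
    by linarith
qed

text \<open>The Dirichlet kernel.\<close>

lemma cheb_U_even_cos:
  "poly (cheb_U (2 * n)) (cos t) = 1 + 2 * (\<Sum>j=1..n. cos (2 * real j * t))"
proof (induction n)
  case (Suc n)
  then show ?case
    using cheb_U_Suc_Suc_cos[of "2 * n" t] by (simp add: algebra_simps)
qed simp

text \<open>
  The conjugate Dirichlet kernel. The sum telescopes: passing from \<open>n\<close> to \<open>n + 1\<close> adds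
  \<open>2 sin ((n + 1) t) cos ((n + 1) t)\<close> to the left-hand side.
\<close>

lemma cheb_U_cos_mult_sin:
  "poly (cheb_U n) (cos t) * sin (real n * t) = (\<Sum>j=1..n. sin (2 * real j * t))"
proof (induction n)
  case (Suc n)
  let ?U = "\<lambda>n. poly (cheb_U n) (cos t)"
  let ?s = "sin (real (Suc n) * t)" and ?c = "cos (real (Suc n) * t)"
  have pred: "sin (real n * t) = ?s * cos t - ?c * sin t"
    using sin_diff[of "real (Suc n) * t" t] by (simp add: algebra_simps)
  have "?U (Suc n) * ?s = ?U n * sin (real n * t) + (?U n * sin t) * ?c + ?s * ?c"
    unfolding cheb_U_Suc_cos pred by algebra
  also have "\<dots> = ?U n * sin (real n * t) + 2 * ?s * ?c"
    unfolding cheb_U_cos_mult_sin_angle by simp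
  also have "2 * ?s * ?c = sin (2 * real (Suc n) * t)"
    using sin_double[of "real (Suc n) * t"] by (simp only: mult.assoc)
  finally show ?case
    using Suc.IH by simp
qed simp

text \<open>
  With a free phase \<open>p\<close>, differentiation stays within one family of functions, since a cosine is
  a sine advanced by a quarter turn; a constant is the term of frequency \<open>0\<close>.
\<close>

lemma funpow_deriv_sum_sin:
  fixes a w :: "'i \<Rightarrow> real"
  shows "(deriv ^^ m) (\<lambda>x. \<Sum>j\<in>A. a j * sin (w j * x + p))
       = (\<lambda>x. \<Sum>j\<in>A. a j * w j ^ m * sin (w j * x + p + real m * (pi / 2)))"
proof (induction m)
  case (Suc m)
  have "deriv (\<lambda>x. \<Sum>j\<in>A. a j * w j ^ m * sin (w j * x + p + real m * (pi / 2))) x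
      = (\<Sum>j\<in>A. a j * w j ^ Suc m * sin (w j * x + p + real (Suc m) * (pi / 2)))" for x
  proof (rule DERIV_imp_deriv, rule DERIV_sum)
    fix j
    have "w j * x + p + real (Suc m) * (pi / 2) = (w j * x + p + real m * (pi / 2)) + pi / 2"
      by (simp add: algebra_simps add_divide_distrib)
    then have "sin (w j * x + p + real (Suc m) * (pi / 2)) = cos (w j * x + p + real m * (pi / 2))"
      by (simp only: sin_add sin_pi_half cos_pi_half)
    then show "((\<lambda>x. a j * w j ^ m * sin (w j * x + p + real m * (pi / 2))) has_field_derivative
        a j * w j ^ Suc m * sin (w j * x + p + real (Suc m) * (pi / 2))) (at x)"
      by (auto intro!: derivative_eq_intros)
  qed
  then show ?case
    by (simp only: funpow.simps o_apply Suc.IH)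
qed simp

lemma sin_pi_half_add_mult_pi: "sin (pi / 2 + real k * pi) = (-1) ^ k"
  by (simp add: sin_add mult.commute)

theorem mainTheorem7:
  fixes n k :: nat
  assumes "n \<ge> 1" and "k \<ge> 1"
  shows "real (power_sum n (2 * k)) =
           1 / 2 * (-1) ^ k *
             (deriv ^^ (2 * k)) (\<lambda>x::real. poly (cheb_U (2 * n)) (cos (x / 2))) 0
       \<and> real (power_sum n (2 * k - 1)) =
           (-1) ^ (k - 1) *
             (deriv ^^ (2 * k - 1))
               (\<lambda>x::real. poly (cheb_U n) (cos (x / 2)) * sin (real n * x / 2)) 0"
proof
  define a :: "nat \<Rightarrow> real" where "a j = (if j = 0 then 1 else 2)" for j
  have "poly (cheb_U (2 * n)) (cos (x / 2)) = (\<Sum>j=0..n. a j * sin (real j * x + pi / 2))" for x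
    unfolding cheb_U_even_cos
    by (simp add: sum.atLeast_Suc_atMost[of 0 n] a_def sin_add sum_distrib_left)
  then have "(deriv ^^ (2 * k)) (\<lambda>x. poly (cheb_U (2 * n)) (cos (x / 2))) 0
      = (\<Sum>j=0..n. a j * real j ^ (2 * k) * sin (pi / 2 + real k * pi))"
    by (simp add: funpow_deriv_sum_sin)
  \<comment> \<open>Since \<open>2 * k > 0\<close>, the constant term of the Dirichlet kernel, \<open>j = 0\<close>, drops out here.\<close>
  also have "\<dots> = 2 * (-1) ^ k * real (power_sum n (2 * k))"
    unfolding sin_pi_half_add_mult_pi using \<open>k \<ge> 1\<close>
    by (simp add: sum.atLeast_Suc_atMost[of 0 n] a_def power_sum_def sum_distrib_left mult_ac)
  finally show "real (power_sum n (2 * k)) =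
      1 / 2 * (-1) ^ k * (deriv ^^ (2 * k)) (\<lambda>x. poly (cheb_U (2 * n)) (cos (x / 2))) 0"
    by (simp flip: power_add mult_2)
next
  from \<open>k \<ge> 1\<close> obtain l where k: "k = Suc l"
    by (cases k) auto
  have quarter_turns: "real (2 * k - 1) * (pi / 2) = pi / 2 + real l * pi"
    by (simp add: k field_simps)
  have "poly (cheb_U n) (cos (x / 2)) * sin (real n * x / 2) = (\<Sum>j=1..n. 1 * sin (real j * x + 0))"
    for x
    using cheb_U_cos_mult_sin[of n "x / 2"] by simp
  then have "(deriv ^^ (2 * k - 1))
        (\<lambda>x. poly (cheb_U n) (cos (x / 2)) * sin (real n * x / 2)) 0
      = (\<Sum>j=1..n. real j ^ (2 * k - 1) * sin (real (2 * k - 1) * (pi / 2)))"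
    by (simp only: funpow_deriv_sum_sin) simp
  also have "\<dots> = (-1) ^ l * real (power_sum n (2 * k - 1))"
    unfolding quarter_turns sin_pi_half_add_mult_pi
    by (simp add: power_sum_def sum_distrib_left mult.commute)
  finally show "real (power_sum n (2 * k - 1)) =
      (-1) ^ (k - 1) * (deriv ^^ (2 * k - 1))
        (\<lambda>x. poly (cheb_U n) (cos (x / 2)) * sin (real n * x / 2)) 0"
    by (simp add: k flip: power_add mult_2 mult.assoc)
qed

end
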